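(* Consider an instance of UJSSP in which all jobs have the same success probability, i.e. $\pi_j=\pi$ for all $j\in J$ for some $\pi\in[0,1]$. Then the greedy algorithm returns an optimal solution, i.e. a set $S^*\subseteq J$ with $z(S^* )=\max_{S\subseteq J} z(S)$.
   Context: UJSSP (Unreliable Job Selection and Sequencing Problem): there is a set $J=\{1,\dots,n\}$ of jobs; job $j$ has a cost $c_j\ge 0$, a reward $r_j\ge 0$, and a success probability $\pi_j\in[0,1]$. For a subset $S\subseteq J$ and a sequence $\sigma$ of the jobs of $S$ (with $\sigma(k)$ the $k$-th job), the expected net profit is $z(S,\sigma)=\sum_{k=1}^{|S|} r_{\sigma(k)}\prod_{i=1}^{k}\pi_{\sigma(i)}-\sum_{j\in S}c_j$. Let $z(S)=\max_\sigma z(S,\sigma)$ (with $z(\emptyset)=0$). UJSSP asks for $S\subseteq J$ maximizing $z(S)$. The greedy algorithm: set $S_0=\emptyset$, $i=0$; while $i<n$ and there is a job $j\notin S_i$ with $z(S_i\cup\{j\})>z(S_i)$, choose a job $k\notin S_i$ maximizing $z(S_i\cup\{k\})$ over $k\notin S_i$, set $S_{i+1}=S_i\cup\{k\}$ and $i\leftarrow i+1$; finally return $S_i$. *)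

theory Defs
  imports Complex_Main "HOL-Combinatorics.Multiset_Permutations"
begin

definition jobs :: "nat \<Rightarrow> nat set" where
  "jobs n = {1..n}"

definition ujssp_instance ::
    "nat \<Rightarrow> (nat \<Rightarrow> real) \<Rightarrow> (nat \<Rightarrow> real) \<Rightarrow> (nat \<Rightarrow> real) \<Rightarrow> bool" where
  "ujssp_instance n c r p \<longleftrightarrow>
     (\<forall>j\<in>jobs n. 0 \<le> c j \<and> 0 \<le> r j \<and> 0 \<le> p j \<and> p j \<le> 1)"

text \<open>A sequence of the jobs of \<open>S\<close> is a list in \<open>permutations_of_set S\<close>; list
  positions are counted from 0, so the \<open>k\<close>-th job is \<open>xs ! (k - 1)\<close>.\<close>

definition seq_profit ::
    "(nat \<Rightarrow> real) \<Rightarrow> (nat \<Rightarrow> real) \<Rightarrow> (nat \<Rightarrow> real) \<Rightarrow> nat set \<Rightarrow> nat list \<Rightarrow> real" where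
  "seq_profit c r p S xs =
     (\<Sum>k<card S. r (xs ! k) * (\<Prod>i\<le>k. p (xs ! i))) - (\<Sum>j\<in>S. c j)"

definition profit ::
    "(nat \<Rightarrow> real) \<Rightarrow> (nat \<Rightarrow> real) \<Rightarrow> (nat \<Rightarrow> real) \<Rightarrow> nat set \<Rightarrow> real" where
  "profit c r p S = Max (seq_profit c r p S ` permutations_of_set S)"

definition optimal_solution ::
    "nat \<Rightarrow> (nat \<Rightarrow> real) \<Rightarrow> (nat \<Rightarrow> real) \<Rightarrow> (nat \<Rightarrow> real) \<Rightarrow> nat set \<Rightarrow> bool" where
  "optimal_solution n c r p S \<longleftrightarrow>
     S \<subseteq> jobs n \<and> profit c r p S = Max (profit c r p ` Pow (jobs n))"

definition greedy_guard ::
    "nat \<Rightarrow> (nat \<Rightarrow> real) \<Rightarrow> (nat \<Rightarrow> real) \<Rightarrow> (nat \<Rightarrow> real) \<Rightarrow> nat \<Rightarrow> nat set \<Rightarrow> bool" where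
  "greedy_guard n c r p i S \<longleftrightarrow>
     i < n \<and> (\<exists>j\<in>jobs n - S. profit c r p (insert j S) > profit c r p S)"

text \<open>\<open>greedy_state n c r p i S\<close>: some run of the greedy algorithm reaches \<open>S\<^sub>i = S\<close>.
  Ties between maximizing jobs may be broken arbitrarily, so the algorithm is
  a nondeterministic transition system; each step increases \<open>i\<close> and requires \<open>i < n\<close>,
  hence there are no infinite runs.\<close>

inductive greedy_state ::
    "nat \<Rightarrow> (nat \<Rightarrow> real) \<Rightarrow> (nat \<Rightarrow> real) \<Rightarrow> (nat \<Rightarrow> real) \<Rightarrow> nat \<Rightarrow> nat set \<Rightarrow> bool"
  for n c r p where
  init: "greedy_state n c r p 0 {}"
| step: "greedy_state n c r p (Suc i) (insert k S)"
  if "greedy_state n c r p i S"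
    and "greedy_guard n c r p i S"
    and "k \<in> jobs n - S"
    and "\<forall>j\<in>jobs n - S. profit c r p (insert j S) \<le> profit c r p (insert k S)"

definition greedy_returns ::
    "nat \<Rightarrow> (nat \<Rightarrow> real) \<Rightarrow> (nat \<Rightarrow> real) \<Rightarrow> (nat \<Rightarrow> real) \<Rightarrow> nat set \<Rightarrow> bool" where
  "greedy_returns n c r p S \<longleftrightarrow>
     (\<exists>i. greedy_state n c r p i S \<and> \<not> greedy_guard n c r p i S)"

end

theory Submission
  imports Defs
begin

text \<open>
  With a common success probability, an optimal sequence sorts the jobs by decreasing reward.
  Writing the rewards as sums of nonnegative increments over the thresholds \<open>v\<close> below them, the
  profit of \<open>S\<close> becomes \<open>(\<Sum>v. a v * g (card {j\<in>S. v \<le> r j})) - (\<Sum>j\<in>S. c j)\<close>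
  with \<open>g m = \<pi> + \<dots> + \<pi>\<^sup>m\<close> concave. The layers \<open>{j. v \<le> r j}\<close> form a chain, so this
  function is submodular and has the exchange property of M-natural-concave functions: for
  \<open>S \<subset> O\<close> and \<open>k \<notin> O\<close>, the job \<open>j \<in> O - S\<close> of largest reward satisfies
  \<open>z(S + k) + z(O) \<le> z(S + j) + z(O - j + k)\<close>. By the exchange property every greedy set
  extends to an optimal one, and by submodularity the greedy set is optimal when no single
  job improves it.
\<close>

section \<open>Geometric sums and threshold increments\<close>

definition geometric_gain :: "real \<Rightarrow> nat \<Rightarrow> real" where
  "geometric_gain q m = (\<Sum>k<m. q ^ Suc k)"

definition layer_value ::
    "real \<Rightarrow> real set \<Rightarrow> (real \<Rightarrow> real) \<Rightarrow> (nat \<Rightarrow> real) \<Rightarrow> nat set \<Rightarrow> real" where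
  "layer_value q V a r S = (\<Sum>v\<in>V. a v * geometric_gain q (card {j\<in>S. v \<le> r j}))"

lemma geometric_gain_Suc: "geometric_gain q (Suc m) = geometric_gain q m + q ^ Suc m"
  by (simp add: geometric_gain_def)

text \<open>The increments \<open>q ^ Suc m\<close> decrease in \<open>m\<close> because
  \<open>q\<close> lies in [0,1]. The two-point form fits the case of one job entering two layers of
  different sizes.\<close>

lemma geometric_gain_concave:
  assumes "0 \<le> q" "q \<le> 1" "m \<le> m'"
  shows "geometric_gain q m + geometric_gain q (Suc m') \<le> geometric_gain q (Suc m) + geometric_gain q m'"
proof -
  have "q ^ Suc m' \<le> q ^ Suc m"
    using assms by (intro power_decreasing) auto
  then show ?thesis
    unfolding geometric_gain_Suc by linarith
qed

text \<open>Moving positions as far forward as possible only increases the powers. When the largest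
  position \<open>b\<close> is added, all of \<open>A\<close> lies below it, so
  \<open>card A \<le> b\<close>, and the term at \<open>b\<close> is at most the next term of the
  geometric sum.\<close>

lemma sum_power_le_geometric_gain:
  assumes "0 \<le> q" "q \<le> 1" "finite K"
  shows "(\<Sum>k\<in>K. q ^ Suc k) \<le> geometric_gain q (card K)"
  using assms(3)
proof (induction K rule: finite_linorder_max_induct)
  case empty
  show ?case by (simp add: geometric_gain_def)
next
  case (insert b A)
  then have "A \<subseteq> {..<b}" "b \<notin> A" by auto
  then have "card A \<le> b"
    using card_mono[of "{..<b}" A] by simp
  then have "q ^ Suc b \<le> q ^ Suc (card A)"
    using assms(1,2) by (intro power_decreasing) auto
  then show ?case
    using insert \<open>b \<notin> A\<close> by (simp add: geometric_gain_Suc del: power_Suc)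
qed

text \<open>Take for \<open>a v\<close> the difference between \<open>v\<close> and its predecessor
  in \<open>V\<close>, with 0 before the least element; the sums telescope. In the induction,
  \<open>sum a A\<close> is \<open>Max A\<close>, or 0 for empty \<open>A\<close>.\<close>

lemma ex_nonneg_increments:
  fixes V :: "real set"
  assumes "finite V" "\<forall>v\<in>V. 0 \<le> v"
  shows "\<exists>a. (\<forall>v\<in>V. 0 \<le> a v) \<and> (\<forall>x\<in>V. (\<Sum>v | v \<in> V \<and> v \<le> x. a v) = x)"
  using assms
proof (induction V rule: finite_linorder_max_induct)
  case empty
  show ?case by simp
next
  case (insert b A)
  then obtain a where a: "\<forall>v\<in>A. 0 \<le> a v" "\<forall>x\<in>A. (\<Sum>v | v \<in> A \<and> v \<le> x. a v) = x"
    by auto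
  have "b \<notin> A" using insert by auto
  have "sum a A \<le> b"
  proof (cases "A = {}")
    case True
    then show ?thesis using insert by simp
  next
    case False
    then have M: "Max A \<in> A" using insert by simp
    have "{v. v \<in> A \<and> v \<le> Max A} = A" using insert by auto
    then have "sum a A = Max A" using a(2) M by metis
    then show ?thesis using insert M by force
  qed
  define a' where "a' = a(b := b - sum a A)"
  have eq: "sum a' A = sum a A"
    using \<open>b \<notin> A\<close> by (auto simp: a'_def intro: sum.cong)
  have "(\<Sum>v | v \<in> insert b A \<and> v \<le> x. a' v) = x" if "x \<in> insert b A" for x
  proof (cases "x = b")
    case True
    have "{v. v \<in> insert b A \<and> v \<le> b} = insert b A"
      using insert by auto
    then show ?thesis
      using True insert \<open>b \<notin> A\<close> by (simp add: eq) (simp add: a'_def)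
  next
    case False
    then have "x \<in> A" "x < b" using that insert by auto
    then have "{v. v \<in> insert b A \<and> v \<le> x} = {v. v \<in> A \<and> v \<le> x}" by auto
    moreover have "(\<Sum>v | v \<in> A \<and> v \<le> x. a' v) = (\<Sum>v | v \<in> A \<and> v \<le> x. a v)"
      using \<open>b \<notin> A\<close> by (intro sum.cong) (auto simp: a'_def)
    ultimately show ?thesis using a(2) \<open>x \<in> A\<close> by simp
  qed
  moreover have "\<forall>v\<in>insert b A. 0 \<le> a' v"
    using a(1) \<open>sum a A \<le> b\<close> by (auto simp: a'_def)
  ultimately show ?case by blast
qed

section \<open>Submodularity and exchange for layer values\<close>

lemma card_layer_insert:
  assumes "finite S" "k \<notin> S"
  shows "card {j \<in> insert k S. v \<le> r j} =
    (if v \<le> r k then Suc (card {j\<in>S. v \<le> r j}) else card {j\<in>S. v \<le> (r j :: real)})"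
proof -
  have "{j \<in> insert k S. v \<le> r j} =
      (if v \<le> r k then insert k {j\<in>S. v \<le> r j} else {j\<in>S. v \<le> r j})"
    by auto
  then show ?thesis using assms by simp
qed

text \<open>Compare layer by layer. If \<open>v \<le> r k\<close>, then \<open>k\<close> raises both
  counts by one and concavity applies; otherwise both sides agree.\<close>

lemma layer_value_submodular:
  assumes "0 \<le> q" "q \<le> 1" "\<forall>v\<in>V. 0 \<le> a v" "finite T" "S \<subseteq> T" "k \<notin> T"
  shows "layer_value q V a r (insert k T) + layer_value q V a r S
    \<le> layer_value q V a r T + layer_value q V a r (insert k S)"
proof -
  have "finite S" "k \<notin> S" using assms finite_subset by auto
  have "a v * geometric_gain q (card {j \<in> insert k T. v \<le> r j})
        + a v * geometric_gain q (card {j\<in>S. v \<le> r j})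
      \<le> a v * geometric_gain q (card {j\<in>T. v \<le> r j})
        + a v * geometric_gain q (card {j \<in> insert k S. v \<le> r j})" if "v \<in> V" for v
  proof -
    have "card {j\<in>S. v \<le> r j} \<le> card {j\<in>T. v \<le> r j}"
      using assms by (intro card_mono) auto
    from geometric_gain_concave[OF assms(1,2) this] show ?thesis
      unfolding card_layer_insert[OF \<open>finite T\<close> \<open>k \<notin> T\<close>]
        card_layer_insert[OF \<open>finite S\<close> \<open>k \<notin> S\<close>] distrib_left[symmetric]
      using assms(3) that by (intro mult_left_mono) auto
  qed
  then show ?thesis
    unfolding layer_value_def sum.distrib[symmetric] by (rule sum_mono)
qed

text \<open>Take for \<open>j\<close> a job of largest reward in \<open>T - S\<close>. In a layer
  containing both \<open>j\<close> and \<open>k\<close>, or neither, the two sides agree. With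
  \<open>j\<close> alone in the layer, concavity decides. With \<open>k\<close> alone, concavity
  points the wrong way, but the layer then misses all of \<open>T - S\<close>, and the two sides
  agree again.\<close>

lemma layer_value_exchange:
  assumes "0 \<le> q" "q \<le> 1" "\<forall>v\<in>V. 0 \<le> a v" "finite T" "S \<subset> T" "k \<notin> T"
  shows "\<exists>j\<in>T - S. layer_value q V a r (insert k S) + layer_value q V a r T
    \<le> layer_value q V a r (insert j S) + layer_value q V a r (insert k (T - {j}))"
proof -
  have "finite (r ` (T - S))" "r ` (T - S) \<noteq> {}" using assms by auto
  from Max_in[OF this] obtain j where j: "j \<in> T - S" "r j = Max (r ` (T - S))"
    by auto
  have jmax: "r i \<le> r j" if "i \<in> T - S" for i
    using that j \<open>finite (r ` (T - S))\<close> by simp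
  have fin: "finite S" "finite (T - {j})" using assms finite_subset by auto
  have notin: "k \<notin> S" "j \<notin> S" "k \<notin> T - {j}" "j \<notin> T - {j}" using assms j by auto
  have T: "insert j (T - {j}) = T" using j by auto
  have "a v * geometric_gain q (card {j \<in> insert k S. v \<le> r j})
        + a v * geometric_gain q (card {j\<in>T. v \<le> r j})
      \<le> a v * geometric_gain q (card {i \<in> insert j S. v \<le> r i})
        + a v * geometric_gain q (card {i \<in> insert k (T - {j}). v \<le> r i})" if "v \<in> V" for v
  proof -
    let ?s = "card {i\<in>S. v \<le> r i}" and ?t = "card {i \<in> T - {j}. v \<le> r i}"
    have "?s \<le> ?t"
      using assms j by (intro card_mono) auto
    note concave = geometric_gain_concave[OF assms(1,2) this]
    \<comment> \<open>The choice of \<open>j\<close> enters here: if its reward is below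
      \<open>v\<close>, so is every reward in \<open>T - S\<close>.\<close>
    have tight: "?s = ?t" if "\<not> v \<le> r j"
    proof -
      have "{i\<in>S. v \<le> r i} = {i \<in> T - {j}. v \<le> r i}"
        using jmax that assms(5) j by force
      then show ?thesis by simp
    qed
    have T_card: "card {i\<in>T. v \<le> r i} = (if v \<le> r j then Suc ?t else ?t)"
      using card_layer_insert[OF fin(2) notin(4), of v r] unfolding T .
    show ?thesis
      unfolding T_card card_layer_insert[OF fin(1) notin(1)] card_layer_insert[OF fin(1) notin(2)]
        card_layer_insert[OF fin(2) notin(3)] distrib_left[symmetric]
      using assms(3) \<open>v \<in> V\<close> concave tight by (intro mult_left_mono) auto
  qed
  then have "layer_value q V a r (insert k S) + layer_value q V a r T
    \<le> layer_value q V a r (insert j S) + layer_value q V a r (insert k (T - {j}))"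
    unfolding layer_value_def sum.distrib[symmetric] by (rule sum_mono)
  then show ?thesis using j by blast
qed

section \<open>Profit of a set as a layer value\<close>

lemma card_nth_positions:
  assumes "distinct xs" "set xs = S"
  shows "card {k. k < length xs \<and> P (xs ! k)} = card {j\<in>S. P j}"
proof (rule bij_betw_same_card[of "nth xs"])
  show "bij_betw (nth xs) {k. k < length xs \<and> P (xs ! k)} {j\<in>S. P j}"
    using assms by (auto simp: bij_betw_def inj_on_nth in_set_conv_nth)
qed

text \<open>This is the equality case of \<open>sum_power_le_geometric_gain\<close>: a finite
  downward closed set of positions is an initial segment.\<close>

lemma geometric_gain_downset:
  assumes "finite K" "\<And>k l. k \<in> K \<Longrightarrow> l < k \<Longrightarrow> l \<in> K"
  shows "(\<Sum>k\<in>K. q ^ Suc k) = geometric_gain q (card K)"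
proof -
  have "\<exists>m. K = {..<m}"
  proof (cases "K = {}")
    case True
    then show ?thesis by (intro exI[of _ 0]) simp
  next
    case False
    have "l \<in> K \<longleftrightarrow> l \<le> Max K" for l
      using assms(2)[OF Max_in[OF assms(1) False], of l] Max_in[OF assms(1) False]
        Max_ge[OF assms(1), of l] by (cases "l = Max K") auto
    then have "K = {..Max K}" by blast
    then show ?thesis by (metis lessThan_Suc_atMost)
  qed
  then obtain m where "K = {..<m}" ..
  then show ?thesis by (simp add: geometric_gain_def)
qed

text \<open>Expanding each reward into increments and swapping the sums turns the value of a
  sequence into a sum over layers of powers at the positions the layer occupies. Each layer is
  bounded by \<open>geometric_gain\<close> of its size, and the order by decreasing reward attains
  all these bounds at once.\<close>

lemma profit_eq_layer_value:
  assumes q: "0 \<le> q" "q \<le> 1"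
    and V: "finite V" "\<forall>v\<in>V. 0 \<le> a v"
    and increments: "\<forall>j\<in>S. (\<Sum>v | v \<in> V \<and> v \<le> r j. a v) = r j"
    and S: "finite S" "\<forall>j\<in>S. p j = q"
  shows "profit c r p S = layer_value q V a r S - sum c S"
proof -
  let ?K = "\<lambda>xs v. {k. k < length xs \<and> v \<le> r (xs ! k)}"
  have layers: "seq_profit c r p S xs = (\<Sum>v\<in>V. a v * (\<Sum>k\<in>?K xs v. q ^ Suc k)) - sum c S"
    if "xs \<in> permutations_of_set S" for xs
  proof -
    have xs: "set xs = S" "distinct xs" "length xs = card S"
      using that by (auto simp: permutations_of_set_def distinct_card)
    have "(\<Sum>k<card S. r (xs ! k) * (\<Prod>i\<le>k. p (xs ! i)))
        = (\<Sum>k<length xs. (\<Sum>v\<in>V. if v \<le> r (xs ! k) then a v * q ^ Suc k else 0))"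
      unfolding xs(3)[symmetric]
    proof (rule sum.cong)
      fix k assume "k \<in> {..<length xs}"
      then have in_S: "xs ! i \<in> S" if "i \<le> k" for i
        using xs(1) that by auto
      have "(\<Prod>i\<le>k. p (xs ! i)) = (\<Prod>i\<le>k. q)"
        using in_S S by (intro prod.cong) auto
      moreover have "r (xs ! k) = (\<Sum>v | v \<in> V \<and> v \<le> r (xs ! k). a v)"
        using increments in_S by simp
      then have "r (xs ! k) * q ^ Suc k
          = (\<Sum>v | v \<in> V \<and> v \<le> r (xs ! k). a v * q ^ Suc k)"
        by (metis sum_distrib_right)
      moreover have "\<dots> = (\<Sum>v\<in>V. if v \<le> r (xs ! k) then a v * q ^ Suc k else 0)"
        using V(1) by (intro sum.inter_filter)
      ultimately show "r (xs ! k) * (\<Prod>i\<le>k. p (xs ! i))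
          = (\<Sum>v\<in>V. if v \<le> r (xs ! k) then a v * q ^ Suc k else 0)"
        by simp
    qed simp
    also have "\<dots> = (\<Sum>v\<in>V. \<Sum>k<length xs. if v \<le> r (xs ! k) then a v * q ^ Suc k else 0)"
      by (rule sum.swap)
    also have "\<dots> = (\<Sum>v\<in>V. a v * (\<Sum>k\<in>?K xs v. q ^ Suc k))"
    proof (rule sum.cong)
      fix v
      have "?K xs v = {k \<in> {..<length xs}. v \<le> r (xs ! k)}" by auto
      then show "(\<Sum>k<length xs. if v \<le> r (xs ! k) then a v * q ^ Suc k else 0)
          = a v * (\<Sum>k\<in>?K xs v. q ^ Suc k)"
        unfolding sum_distrib_left
        using sum.inter_filter[of "{..<length xs}" "\<lambda>k. a v * q ^ Suc k" "\<lambda>k. v \<le> r (xs ! k)"]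
        by simp
    qed simp
    finally show ?thesis
      by (simp only: seq_profit_def)
  qed
  have card_K: "card (?K xs v) = card {j\<in>S. v \<le> r j}" if "xs \<in> permutations_of_set S" for xs v
    using that card_nth_positions[of xs S "\<lambda>j. v \<le> r j"] by (simp add: permutations_of_set_def)
  define ys where "ys = sort_key (\<lambda>j. - r j) (sorted_list_of_set S)"
  have ys: "ys \<in> permutations_of_set S"
    using S(1) by (simp add: ys_def permutations_of_set_def)
  have "sorted (map (\<lambda>j. - r j) ys)"
    by (simp add: ys_def)
  then have decreasing: "r (ys ! k) \<le> r (ys ! l)" if "l < k" "k < length ys" for k l
    using that sorted_nth_mono[of "map (\<lambda>j. - r j) ys" l k] by simp
  \<comment> \<open>Under decreasing rewards, every position before a job of layer \<open>v\<close>
    also holds a job of layer \<open>v\<close>.\<close>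
  have "(\<Sum>k\<in>?K ys v. q ^ Suc k) = geometric_gain q (card {j\<in>S. v \<le> r j})" for v
    unfolding card_K[OF ys, symmetric]
    by (rule geometric_gain_downset) (use decreasing in \<open>fastforce+\<close>)
  then have sorted_value: "seq_profit c r p S ys = layer_value q V a r S - sum c S"
    unfolding layers[OF ys] layer_value_def by simp
  have upper: "seq_profit c r p S xs \<le> layer_value q V a r S - sum c S"
    if "xs \<in> permutations_of_set S" for xs
  proof -
    have "(\<Sum>k\<in>?K xs v. q ^ Suc k) \<le> geometric_gain q (card {j\<in>S. v \<le> r j})" for v
      unfolding card_K[OF that, symmetric] by (rule sum_power_le_geometric_gain[OF q]) simp
    then show ?thesis
      unfolding layers[OF that] layer_value_def
      using V(2) by (intro diff_right_mono sum_mono mult_left_mono) auto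
  qed
  show ?thesis
    unfolding profit_def
    using ys upper sorted_value by (intro Max_eqI) (auto intro: rev_image_eqI)
qed

section \<open>Runs of the greedy algorithm\<close>

lemma greedy_state_subset_card:
  assumes "greedy_state n c r p i S"
  shows "S \<subseteq> jobs n \<and> card S = i"
  using assms
proof induction
  case (step i S k)
  moreover have "finite S"
    using step finite_subset[of S "jobs n"] by (simp add: jobs_def)
  ultimately show ?case by simp
qed simp

text \<open>If no run returned, the guard would hold at every reachable state, and a maximizing job
  could always be added, until \<open>Suc n\<close> jobs were selected out of
  \<open>n\<close>.\<close>

lemma greedy_returns_exists: "\<exists>S. greedy_returns n c r p S"
proof (rule ccontr)
  assume none: "\<nexists>S. greedy_returns n c r p S"
  have "\<exists>S. greedy_state n c r p i S" for i
  proof (induction i)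
    case 0
    show ?case using greedy_state.init by blast
  next
    case (Suc i)
    then obtain S where S: "greedy_state n c r p i S" by blast
    then have guard: "greedy_guard n c r p i S"
      using none by (auto simp: greedy_returns_def)
    let ?values = "(\<lambda>j. profit c r p (insert j S)) ` (jobs n - S)"
    have "finite ?values" "?values \<noteq> {}"
      using guard by (auto simp: greedy_guard_def jobs_def)
    from Max_in[OF this] obtain k where "k \<in> jobs n - S" "profit c r p (insert k S) = Max ?values"
      by auto
    then show ?case
      using greedy_state.step[OF S guard] \<open>finite ?values\<close> by (metis Max_ge imageI)
  qed
  then obtain S where "greedy_state n c r p (Suc n) S" by blast
  then have "S \<subseteq> jobs n" "card S = Suc n"
    using greedy_state_subset_card by auto
  then show False
    using card_mono[of "jobs n" S] by (simp add: jobs_def)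
qed

lemma optimal_solution_iff:
  "optimal_solution n c r p S \<longleftrightarrow> S \<subseteq> jobs n \<and> (\<forall>T\<subseteq>jobs n. profit c r p T \<le> profit c r p S)"
proof -
  have "finite (profit c r p ` Pow (jobs n))" by (simp add: jobs_def)
  then show ?thesis
    unfolding optimal_solution_def by (auto intro!: Max_eqI[symmetric])
qed

text \<open>Invariant of the run: if the new job \<open>k\<close> lies outside the optimal
  \<open>T\<close>, swap it for the \<open>j\<close> given by exchange. As the greedy choice makes
  \<open>insert k S\<close> at least as good as \<open>insert j S\<close>, the swap does not lower
  the profit of \<open>T\<close>.\<close>

lemma greedy_state_extends_to_optimal:
  assumes exchange: "\<And>S T k. T \<subseteq> jobs n \<Longrightarrow> S \<subset> T \<Longrightarrow> k \<in> jobs n - T \<Longrightarrow>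
      \<exists>j\<in>T - S. profit c r p (insert k S) + profit c r p T
        \<le> profit c r p (insert j S) + profit c r p (insert k (T - {j}))"
    and "greedy_state n c r p i S"
  shows "\<exists>T. optimal_solution n c r p T \<and> S \<subseteq> T"
  using assms(2)
proof induction
  case init
  have "finite (profit c r p ` Pow (jobs n))" "profit c r p ` Pow (jobs n) \<noteq> {}"
    by (auto simp: jobs_def)
  from Max_in[OF this] obtain T
    where "T \<subseteq> jobs n" "profit c r p T = Max (profit c r p ` Pow (jobs n))"
    by auto
  then show ?case
    unfolding optimal_solution_def by blast
next
  case (step i S k)
  then obtain T where T: "optimal_solution n c r p T" "S \<subseteq> T" by blast
  have improves: "profit c r p S < profit c r p (insert k S)"
    using step(2,4) by (meson greedy_guard_def less_le_trans)
  show ?case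
  proof (cases "k \<in> T")
    case True
    then show ?thesis using T by blast
  next
    case False
    have "insert k S \<subseteq> jobs n"
      using T step(3) by (auto simp: optimal_solution_iff)
    \<comment> \<open>Exchange needs a proper inclusion. An optimal \<open>S\<close> could not be
      improved by \<open>k\<close>, whereas the guard and the maximality of \<open>k\<close> give a
      strict improvement.\<close>
    then have "S \<noteq> T"
      using T(1) improves unfolding optimal_solution_iff by (meson not_le)
    then obtain j where j: "j \<in> T - S" "profit c r p (insert k S) + profit c r p T
        \<le> profit c r p (insert j S) + profit c r p (insert k (T - {j}))"
      using exchange[of T S k] T step(3) False by (auto simp: optimal_solution_iff)
    have "profit c r p (insert j S) \<le> profit c r p (insert k S)"
      using step(4) j(1) T(1) by (auto simp: optimal_solution_iff)
    then have "profit c r p T \<le> profit c r p (insert k (T - {j}))"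
      using j(2) by linarith
    then have "optimal_solution n c r p (insert k (T - {j}))"
      using T(1) step(3) unfolding optimal_solution_iff by (blast intro: order_trans)
    moreover have "insert k S \<subseteq> insert k (T - {j})"
      using T(2) j(1) by auto
    ultimately show ?thesis by blast
  qed
qed

text \<open>Add the jobs of \<open>D\<close> one at a time: by submodularity, the gain of
  \<open>k\<close> over \<open>S \<union> D\<close> is at most its gain over \<open>S\<close>, which
  is not positive.\<close>

lemma locally_maximal_profit_ge_superset:
  assumes submodular: "\<And>S T k. T \<subseteq> jobs n \<Longrightarrow> S \<subseteq> T \<Longrightarrow> k \<in> jobs n - T \<Longrightarrow>
      profit c r p (insert k T) + profit c r p S \<le> profit c r p T + profit c r p (insert k S)"
    and local_max: "\<forall>j\<in>jobs n - S. profit c r p (insert j S) \<le> profit c r p S"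
    and "S \<subseteq> jobs n" "finite D" "D \<subseteq> jobs n - S"
  shows "profit c r p (S \<union> D) \<le> profit c r p S"
  using assms(4,5)
proof induction
  case (insert k D)
  then have "profit c r p (insert k (S \<union> D)) + profit c r p S
      \<le> profit c r p (S \<union> D) + profit c r p (insert k S)"
    using assms(3) by (intro submodular) auto
  then show ?case
    using insert local_max by force
qed simp

section \<open>Optimality of every returned set\<close>

theorem theorem2:
  fixes n :: nat and c r p :: "nat \<Rightarrow> real" and \<pi> :: real
  assumes "ujssp_instance n c r p"
    and "0 \<le> \<pi>" and "\<pi> \<le> 1"
    and "\<forall>j\<in>jobs n. p j = \<pi>"
  shows "(\<exists>S. greedy_returns n c r p S) \<and>
         (\<forall>S. greedy_returns n c r p S \<longrightarrow> optimal_solution n c r p S)"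
proof (intro conjI allI impI)
  show "\<exists>S. greedy_returns n c r p S"
    by (rule greedy_returns_exists)
next
  fix S assume "greedy_returns n c r p S"
  then obtain i where i: "greedy_state n c r p i S" "\<not> greedy_guard n c r p i S"
    by (auto simp: greedy_returns_def)
  have fin: "finite T" if "T \<subseteq> jobs n" for T
    using that finite_subset by (auto simp: jobs_def)
  \<comment> \<open>Thresholds come from the rewards of all jobs, so one choice of \<open>V\<close>
    and \<open>a\<close> serves every subset and layer values of different sets are
    comparable.\<close>
  define V where "V = r ` jobs n"
  have V: "finite V" "\<forall>v\<in>V. 0 \<le> v"
    using assms(1) by (auto simp: V_def jobs_def ujssp_instance_def)
  then obtain a where a: "\<forall>v\<in>V. 0 \<le> a v" "\<forall>x\<in>V. (\<Sum>v | v \<in> V \<and> v \<le> x. a v) = x"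
    using ex_nonneg_increments by blast
  have profit_value: "profit c r p T = layer_value \<pi> V a r T - sum c T" if "T \<subseteq> jobs n" for T
    using assms(2-4) V a that fin[OF that]
    by (intro profit_eq_layer_value) (auto simp: V_def)
  have exchange: "\<exists>j\<in>T - S. profit c r p (insert k S) + profit c r p T
        \<le> profit c r p (insert j S) + profit c r p (insert k (T - {j}))"
    if *: "T \<subseteq> jobs n" "S \<subset> T" "k \<in> jobs n - T" for S T k
  proof -
    obtain j where j: "j \<in> T - S" "layer_value \<pi> V a r (insert k S) + layer_value \<pi> V a r T
        \<le> layer_value \<pi> V a r (insert j S) + layer_value \<pi> V a r (insert k (T - {j}))"
      using layer_value_exchange[OF assms(2,3) a(1) fin[OF *(1)] *(2), of k r] * by blast
    have sub: "insert k S \<subseteq> jobs n" "insert j S \<subseteq> jobs n" "insert k (T - {j}) \<subseteq> jobs n"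
      using * j by auto
    have "finite S" "finite T" "k \<notin> S" "k \<notin> T" "j \<notin> S" "j \<in> T"
      using * j fin[of S] fin[of T] by auto
    \<comment> \<open>Both sides count the same jobs with multiplicity, so costs cancel and only the
      layer values matter.\<close>
    then have "sum c (insert k S) + sum c T = sum c (insert j S) + sum c (insert k (T - {j}))"
      by (simp add: sum.remove[of T j])
    then show ?thesis
      using j by (intro bexI[of _ j]) (auto simp only: profit_value sub *(1))
  qed
  have submodular: "profit c r p (insert k T) + profit c r p S
      \<le> profit c r p T + profit c r p (insert k S)"
    if *: "T \<subseteq> jobs n" "S \<subseteq> T" "k \<in> jobs n - T" for S T k
  proof -
    have sub: "S \<subseteq> jobs n" "insert k S \<subseteq> jobs n" "insert k T \<subseteq> jobs n"
      using * by auto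
    have "finite S" "finite T" "k \<notin> S" "k \<notin> T"
      using * fin[of S] fin[of T] by auto
    then show ?thesis
      using layer_value_submodular[OF assms(2,3) a(1) \<open>finite T\<close> *(2) \<open>k \<notin> T\<close>, of r]
      by (simp add: profit_value[OF sub(1)] profit_value[OF sub(2)] profit_value[OF sub(3)]
          profit_value[OF *(1)])
  qed
  obtain T where T: "optimal_solution n c r p T" "S \<subseteq> T"
    using greedy_state_extends_to_optimal[OF exchange i(1)] by blast
  have S: "S \<subseteq> jobs n" "card S = i"
    using greedy_state_subset_card[OF i(1)] by auto
  have T_jobs: "T \<subseteq> jobs n" using T(1) by (simp add: optimal_solution_iff)
  have "\<forall>j\<in>jobs n - S. profit c r p (insert j S) \<le> profit c r p S"
  \<comment> \<open>The loop may stop because no job improves \<open>S\<close> or because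
    \<open>i\<close> has reached \<open>n\<close>; in the second case all jobs are selected and the
    claim is vacuous.\<close>
  proof (cases "i < n")
    case True
    then show ?thesis using i(2) by (force simp: greedy_guard_def)
  next
    case False
    then have "S = jobs n"
      using S by (intro card_seteq) (auto simp: jobs_def)
    then show ?thesis by simp
  qed
  \<comment> \<open>With \<open>D = T - S\<close>, the returned set is compared with an optimal set
    containing it.\<close>
  then have "profit c r p (S \<union> (T - S)) \<le> profit c r p S"
    using S(1) T_jobs fin[OF T_jobs]
    by (intro locally_maximal_profit_ge_superset[OF submodular]) auto
  moreover have "S \<union> (T - S) = T" using T(2) by auto
  ultimately show "optimal_solution n c r p S"
    using T(1) S(1) unfolding optimal_solution_iff by (metis order_trans)
qed

end
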